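(* There are $2^{\mathfrak{c}}$ pairwise distinct $\sigma$-ideals on $\mathbb{R}$ of the form $\mathcal{N}_f$, where $f$ is a weak selection on $\mathbb{R}$.
   Context: A weak selection on $\mathbb{R}$ is a function $f:[\mathbb{R}]^2\to\mathbb{R}$ with $f(F)\in F$ for every two-element set $F\subseteq\mathbb{R}$. For distinct $x,y$ write $x<_f y$ if $f(\{x,y\})=x$, and $x\leq_f y$ if $x<_f y$ or $x=y$. For $r,s\in\mathbb{R}$, $(r,s]_f=\{x\in\mathbb{R}: r<_f x\leq_f s\}$ (it is not required that $r<_f s$). For $A\subseteq\mathbb{R}$, $\lambda_f(A)=\inf\{\sum_{n\in\mathbb{N}}|s_n-r_n| : A\subseteq\bigcup_{n\in\mathbb{N}}(r_n,s_n]_f\}$ if $A$ can be covered by countably many intervals $(r,s]_f$, and $\lambda_f(A)=+\infty$ otherwise. $\mathcal{N}_f=\{A\subseteq\mathbb{R}:\lambda_f(A)=0\}$; it is closed under subsets and countable unions. $\mathfrak{c}$ is the cardinality of $\mathbb{R}$. *)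

theory Defs
  imports "HOL-Library.Extended_Nonnegative_Real" "HOL-Library.Equipollence"
begin

(* A function on the two-element sets of reals is encoded as a total function on
   "real set"; its values on all other sets are arbitrary and are never used below. *)
definition weak_selection :: "(real set \<Rightarrow> real) \<Rightarrow> bool" where
  "weak_selection f \<longleftrightarrow> (\<forall>F. card F = 2 \<longrightarrow> f F \<in> F)"

definition sel_less :: "(real set \<Rightarrow> real) \<Rightarrow> real \<Rightarrow> real \<Rightarrow> bool" where
  "sel_less f x y \<longleftrightarrow> x \<noteq> y \<and> f {x, y} = x"

definition sel_le :: "(real set \<Rightarrow> real) \<Rightarrow> real \<Rightarrow> real \<Rightarrow> bool" where
  "sel_le f x y \<longleftrightarrow> sel_less f x y \<or> x = y"

definition sel_Ioc :: "(real set \<Rightarrow> real) \<Rightarrow> real \<Rightarrow> real \<Rightarrow> real set" where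
  "sel_Ioc f r s = {x. sel_less f r x \<and> sel_le f x s}"

(* If A has no countable cover by such intervals, this is the infimum of the empty set,
   which is \<infinity> in ennreal; divergent sums also have the value \<infinity>. *)
definition sel_outer :: "(real set \<Rightarrow> real) \<Rightarrow> real set \<Rightarrow> ennreal" where
  "sel_outer f A =
     Inf {(\<Sum>n. ennreal \<bar>s n - r n\<bar>) | r s :: nat \<Rightarrow> real. A \<subseteq> (\<Union>n. sel_Ioc f (r n) (s n))}"

definition sel_null :: "(real set \<Rightarrow> real) \<Rightarrow> real set set" where
  "sel_null f = {A. sel_outer f A = 0}"

(* Neither properness nor containing the singletons is part of the notion: for a general
   weak selection f, sel_null f may fail to contain some singletons. *)
definition sigma_ideal :: "'a set set \<Rightarrow> bool" where
  "sigma_ideal I \<longleftrightarrow>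
     {} \<in> I \<and>
     (\<forall>A\<in>I. \<forall>B. B \<subseteq> A \<longrightarrow> B \<in> I) \<and>
     (\<forall>A :: nat \<Rightarrow> 'a set. range A \<subseteq> I \<longrightarrow> (\<Union>n. A n) \<in> I)"

end

theory Submission
  imports Defs "HOL-Analysis.Lebesgue_Measure"
begin

text \<open>
  The ideal \<open>sel_null f\<close> depends only on the relation \<open>sel_less f\<close>, a subset of
  \<open>\<real> \<times> \<real>\<close>; hence there are at most \<open>2\<^sup>\<cc>\<close> such ideals (and each is a
  \<open>\<sigma>\<close>-ideal).

  For the lower bound, the usual order of the reals is perturbed in order to make a prescribed set
  \<open>M \<subseteq> (-\<infinity>, 1]\<close> null while keeping the points of \<open>(-\<infinity>, 1] - M\<close> as hard to cover
  as before. Every comparison between a point of \<open>M\<close> and a rational \<open>q > 1\<close> is reversed, all others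
  are kept. Then for each irrational \<open>t > 2\<close> the single interval from \<open>2\<close> to \<open>t\<close>
  contains all of \<open>M\<close>: the rational \<open>2\<close> now lies below \<open>M\<close>, and \<open>t\<close> still lies
  above it. As \<open>t\<close> can be taken arbitrarily close to \<open>2\<close>, the set \<open>M\<close> is null
  (\<open>flipped_null\<close>). A point \<open>x \<le> 1\<close> outside \<open>M\<close> is never affected, so a new
  interval contains it only if the usual interval does (\<open>sel_Ioc_flip_sel_unflipped\<close>).

  It remains to find disjoint sets \<open>B i \<subseteq> [0, 1]\<close>, one for each real \<open>i\<close>, none of
  which has a cover of total length below \<open>1/4\<close> by usual intervals. For
  \<open>M S = (\<Union>i\<in>S. B i)\<close> the set \<open>B i\<close> is then null exactly when \<open>i \<in> S\<close>, so
  distinct sets \<open>S\<close> of reals yield distinct ideals. The \<open>B i\<close> come from a transfinite choice as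
  for Bernstein sets: there are only \<open>\<cc>\<close> pairs of a cheap cover and an index \<open>i\<close>, while each
  cheap cover misses \<open>\<cc>\<close> points of \<open>[0, 1]\<close> (\<open>reals_lepoll_cover_complement\<close>), so
  distinct missed points can be assigned to all these pairs (\<open>injective_choice\<close>).
\<close>

section \<open>Cardinality\<close>

unbundle cardinal_syntax

text \<open>
  Well-order \<open>J\<close> in the least possible order type and choose by recursion: fewer than
  \<open>card_of J\<close> values are in use at each stage, so they cannot exhaust \<open>K a\<close>.
\<close>
lemma injective_choice:
  fixes K :: "'a \<Rightarrow> 'b set"
  assumes large: "\<And>a. a \<in> J \<Longrightarrow> J \<lesssim> K a"
  obtains h where "inj_on h J" "\<And>a. a \<in> J \<Longrightarrow> h a \<in> K a"
proof -
  define r where "r = card_of J"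
  have wo: "Well_order r" and co: "Card_order r" and field: "Field r = J"
    unfolding r_def by (rule card_of_Well_order card_of_Card_order Field_card_of)+
  have rel: "wo_rel r" using wo by (simp add: wo_rel_def)
  define h where
    "h = wfrec (r - Id) (\<lambda>h a. SOME y. y \<in> K a \<and> y \<notin> h ` underS r a)"
  have h_rec: "h a = (SOME y. y \<in> K a \<and> y \<notin> h ` underS r a)" for a
  proof -
    have "cut h (r - Id) a ` underS r a = h ` underS r a"
      by (rule image_cong) (auto simp: underS_def cut_apply)
    then show ?thesis
      unfolding h_def using wo_rel.WF[OF rel] by (subst wfrec) (simp_all add: h_def[symmetric])
  qed
  have h_new: "h a \<in> K a \<and> h a \<notin> h ` underS r a" if a: "a \<in> J" for a
  proof -
    have "card_of (h ` underS r a) \<le>o card_of (underS r a)" by (rule card_of_image)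
    also have "card_of (underS r a) <o r" using card_of_underS[OF co] a field by blast
    also have "r \<le>o card_of (K a)"
      unfolding r_def using large[OF a] by (simp add: card_of_ordLeq[symmetric] lepoll_def)
    finally have "card_of (h ` underS r a) <o card_of (K a)" .
    then have "\<not> K a \<subseteq> h ` underS r a"
      using card_of_mono1 not_ordLess_ordLeq by blast
    then have "\<exists>y. y \<in> K a \<and> y \<notin> h ` underS r a" by blast
    then show ?thesis unfolding h_rec[of a] by (rule someI_ex)
  qed
  have "inj_on h J"
  proof (rule inj_onI, rule ccontr)
    fix a b assume ab: "a \<in> J" "b \<in> J" "h a = h b" "a \<noteq> b"
    then have "a \<in> underS r b \<or> b \<in> underS r a"
      using wo_rel.TOTALS[OF rel] field unfolding underS_def by blast
    then show False using h_new[OF ab(1)] h_new[OF ab(2)] ab(3) by (metis image_eqI)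
  qed
  with h_new that show ?thesis by blast
qed

lemma Times_eqpoll_self: "infinite A \<Longrightarrow> A \<times> A \<approx> A"
  using card_of_Times_same_infinite by (simp add: eqpoll_iff_card_of_ordIso)

lemma real_sequences_lepoll_reals: "(UNIV :: (nat \<Rightarrow> real) set) \<lesssim> (UNIV :: real set)"
proof -
  obtain c :: "real \<Rightarrow> nat set" where c: "inj c"
    using nat_sets_eqpoll_reals eqpoll_sym eqpoll_imp_lepoll unfolding lepoll_def by blast
  define d where "d x = {prod_encode (n, k) | n k. k \<in> c (x n)}" for x :: "nat \<Rightarrow> real"
  have "inj d"
  proof (rule injI, rule ext)
    fix x y :: "nat \<Rightarrow> real" and n assume "d x = d y"
    then have "prod_encode (n, k) \<in> d x \<longleftrightarrow> prod_encode (n, k) \<in> d y" for k by simp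
    then have "c (x n) = c (y n)" by (auto simp: d_def)
    then show "x n = y n" using c by (simp add: inj_eq)
  qed
  then have "(UNIV :: (nat \<Rightarrow> real) set) \<lesssim> (UNIV :: nat set set)"
    unfolding lepoll_def by blast
  then show ?thesis using nat_sets_eqpoll_reals lepoll_trans eqpoll_imp_lepoll by blast
qed


section \<open>The complement of a cheap cover\<close>

lemma emeasure_cover_le:
  fixes r s :: "nat \<Rightarrow> real"
  shows "emeasure lborel (\<Union>n. {r n <.. s n}) \<le> (\<Sum>n. ennreal \<bar>s n - r n\<bar>)"
proof -
  have "emeasure lborel (\<Union>n. {r n <.. s n}) \<le> (\<Sum>n. emeasure lborel {r n <.. s n})"
    by (rule emeasure_subadditive_countably) auto
  also have "\<dots> \<le> (\<Sum>n. ennreal \<bar>s n - r n\<bar>)"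
  proof (intro suminf_le allI summableI)
    fix n show "emeasure lborel {r n <.. s n} \<le> ennreal \<bar>s n - r n\<bar>"
      by (cases "r n \<le> s n") auto
  qed
  finally show ?thesis .
qed

text \<open>
  The argument is in the spirit of Steinhaus: if no two points of the complement \<open>K\<close> differ by
  \<open>t\<close>, then the cover and its translate by \<open>t\<close> together cover \<open>[t, 1]\<close>. Their
  total length is below \<open>1/4 + 1/4\<close>, which is too short when \<open>t \<le> 1/2\<close>. So all \<open>t\<close> in \<open>[0, 1/2]\<close> are
  differences of points of \<open>K\<close>; thus \<open>K \<times> K\<close>, and with it \<open>K\<close>, has at least \<open>\<cc>\<close> elements.
\<close>
lemma reals_lepoll_cover_complement:
  fixes r s :: "nat \<Rightarrow> real"
  assumes small: "(\<Sum>n. ennreal \<bar>s n - r n\<bar>) < ennreal (1/4)"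
  shows "(UNIV :: real set) \<lesssim> {0..1} - (\<Union>n. {r n <.. s n})" (is "_ \<lesssim> ?K")
proof -
  have diff: "\<exists>x\<in>?K. \<exists>y\<in>?K. x - y = t" if t: "0 \<le> t" "t \<le> 1/2" for t
  proof (rule ccontr)
    assume no: "\<not> (\<exists>x\<in>?K. \<exists>y\<in>?K. x - y = t)"
    let ?U = "\<Union>n. {r n <.. s n}" and ?V = "\<Union>n. {r n + t <.. s n + t}"
    have "{t..1} \<subseteq> ?U \<union> ?V"
    proof
      fix x assume x: "x \<in> {t..1}"
      have "x \<in> {0..1}" "x - t \<in> {0..1}" using x t by auto
      moreover have "x \<notin> ?K \<or> x - t \<notin> ?K"
      proof -
        have "x - (x - t) = t" by simp
        then show ?thesis using no by blast
      qed
      ultimately have "x \<in> ?U \<or> x - t \<in> ?U" by blast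
      then show "x \<in> ?U \<union> ?V" by (auto simp: less_diff_eq diff_le_eq)
    qed
    then have "ennreal (1 - t) \<le> emeasure lborel (?U \<union> ?V)"
      using emeasure_mono[of "{t..1}" "?U \<union> ?V" lborel] t by simp
    also have "\<dots> \<le> emeasure lborel ?U + emeasure lborel ?V"
      by (rule emeasure_subadditive) auto
    also have "\<dots> \<le> (\<Sum>n. ennreal \<bar>s n - r n\<bar>) + (\<Sum>n. ennreal \<bar>s n - r n\<bar>)"
      using emeasure_cover_le[of r s] emeasure_cover_le[of "\<lambda>n. r n + t" "\<lambda>n. s n + t"]
      by (intro add_mono) simp_all
    also have "\<dots> < ennreal (1/4) + ennreal (1/4)"
      using small by (intro add_strict_mono)
    also have "\<dots> = ennreal (1/2)" by (simp flip: ennreal_plus)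
    finally have "ennreal (1 - t) < ennreal (1/2)" .
    moreover have "ennreal (1/2) \<le> ennreal (1 - t)" using t by (intro ennreal_leI) simp
    ultimately show False by (rule leD[THEN notE, rotated])
  qed
  have "{0..1/2} \<subseteq> (\<lambda>(x, y). x - y) ` (?K \<times> ?K)"
  proof
    fix t :: real assume "t \<in> {0..1/2}"
    then have "\<exists>x\<in>?K. \<exists>y\<in>?K. x - y = t" by (intro diff) simp_all
    then obtain x y where "x \<in> ?K" "y \<in> ?K" "x - y = t" by (elim bexE)
    then show "t \<in> (\<lambda>(x, y). x - y) ` (?K \<times> ?K)"
      by (intro image_eqI[of _ _ "(x, y)"] SigmaI) simp_all
  qed
  then have half: "{0..1/2::real} \<lesssim> ?K \<times> ?K"
    by (rule lepoll_trans[OF subset_imp_lepoll image_lepoll])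
  have inf: "infinite ?K"
  proof
    assume "finite ?K"
    then have "finite (?K \<times> ?K)" by blast
    then have "finite {0..1/2::real}"
      using half unfolding lepoll_def by (elim exE conjE) (rule inj_on_finite)
    moreover have "infinite {0..1/2::real}" by (rule infinite_Icc) simp
    ultimately show False by contradiction
  qed
  have "?K \<times> ?K \<approx> ?K" using inf by (rule Times_eqpoll_self)
  moreover have "(UNIV :: real set) \<approx> {0..1/2::real}"
    by (rule eqpoll_sym) (simp add: closed_interval_eqpoll_reals)
  ultimately show ?thesis using half lepoll_trans1 lepoll_trans2 by blast
qed

section \<open>Null sets of a weak selection\<close>

lemma sel_null_iff:
  "A \<in> sel_null f \<longleftrightarrow>
     (\<forall>e>0. \<exists>r s. A \<subseteq> (\<Union>n. sel_Ioc f (r n) (s n)) \<and>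
        (\<Sum>n. ennreal \<bar>s n - r n\<bar>) < ennreal e)"
proof
  assume null: "A \<in> sel_null f"
  show "\<forall>e>0. \<exists>r s. A \<subseteq> (\<Union>n. sel_Ioc f (r n) (s n)) \<and>
      (\<Sum>n. ennreal \<bar>s n - r n\<bar>) < ennreal e"
  proof (intro allI impI)
    fix e :: real assume "e > 0"
    with null have "sel_outer f A < ennreal e" by (simp add: sel_null_def)
    then have "\<exists>c\<in>{(\<Sum>n. ennreal \<bar>s n - r n\<bar>) | r s. A \<subseteq> (\<Union>n. sel_Ioc f (r n) (s n))}.
        c < ennreal e"
      by (simp only: sel_outer_def Inf_less_iff)
    then obtain c r s where "c = (\<Sum>n. ennreal \<bar>s n - r n\<bar>)"
      and "A \<subseteq> (\<Union>n. sel_Ioc f (r n) (s n))" and "c < ennreal e"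
      by (elim bexE CollectE exE conjE)
    then show "\<exists>r s. A \<subseteq> (\<Union>n. sel_Ioc f (r n) (s n)) \<and>
      (\<Sum>n. ennreal \<bar>s n - r n\<bar>) < ennreal e" by (intro exI[of _ r] exI[of _ s] conjI) simp_all
  qed
next
  assume cov: "\<forall>e>0. \<exists>r s. A \<subseteq> (\<Union>n. sel_Ioc f (r n) (s n)) \<and>
      (\<Sum>n. ennreal \<bar>s n - r n\<bar>) < ennreal e"
  have small: "sel_outer f A \<le> 0 + ennreal e" if e: "e > 0" for e
  proof -
    obtain r s where rs: "A \<subseteq> (\<Union>n. sel_Ioc f (r n) (s n))"
      "(\<Sum>n. ennreal \<bar>s n - r n\<bar>) < ennreal e" using cov[rule_format, OF e] by (elim exE conjE)
    then have "sel_outer f A \<le> (\<Sum>n. ennreal \<bar>s n - r n\<bar>)"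
      unfolding sel_outer_def
      by (intro Inf_lower CollectI exI[of _ r] exI[of _ s] conjI refl)
    with rs(2) show ?thesis by simp
  qed
  have "sel_outer f A \<le> 0" by (rule ennreal_le_epsilon) (rule small)
  then show "A \<in> sel_null f" by (simp add: sel_null_def)
qed

lemma sigma_ideal_sel_null: "sigma_ideal (sel_null f)"
  unfolding sigma_ideal_def
proof (intro conjI ballI allI impI)
  show "{} \<in> sel_null f"
    unfolding sel_null_iff by (intro allI impI exI[of _ "\<lambda>_. 0"]) simp
next
  fix A B assume "A \<in> sel_null f" "B \<subseteq> A"
  show "B \<in> sel_null f"
    unfolding sel_null_iff
  proof (intro allI impI)
    fix e :: real assume "e > 0"
    with \<open>A \<in> sel_null f\<close> obtain r s where
      "A \<subseteq> (\<Union>n. sel_Ioc f (r n) (s n))" "(\<Sum>n. ennreal \<bar>s n - r n\<bar>) < ennreal e"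
      unfolding sel_null_iff by (elim allE[of _ e] impE exE conjE)
    with \<open>B \<subseteq> A\<close> show "\<exists>r s. B \<subseteq> (\<Union>n. sel_Ioc f (r n) (s n)) \<and>
        (\<Sum>n. ennreal \<bar>s n - r n\<bar>) < ennreal e"
      by (intro exI[of _ r] exI[of _ s] conjI order_trans[OF \<open>B \<subseteq> A\<close>])
  qed
next
  fix A :: "nat \<Rightarrow> real set" assume "range A \<subseteq> sel_null f"
  then have null: "A m \<in> sel_null f" for m by blast
  show "(\<Union>m. A m) \<in> sel_null f"
    unfolding sel_null_iff
  proof (intro allI impI)
    fix e :: real assume e: "e > 0"
    \<comment> \<open>The lengths add up to at most \<open>e / 2\<close>; the factor \<open>1/2\<close> makes the final bound strict.\<close>
    have "\<forall>m. \<exists>r s. A m \<subseteq> (\<Union>n. sel_Ioc f (r n) (s n)) \<and>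
        (\<Sum>n. ennreal \<bar>s n - r n\<bar>) < ennreal (e / 2 * (1/2) ^ Suc m)"
    proof
      fix m
      have "e / 2 * (1/2) ^ Suc m > 0" using e by simp
      then show "\<exists>r s. A m \<subseteq> (\<Union>n. sel_Ioc f (r n) (s n)) \<and>
        (\<Sum>n. ennreal \<bar>s n - r n\<bar>) < ennreal (e / 2 * (1/2) ^ Suc m)"
        using null[of m] unfolding sel_null_iff by (elim allE impE)
    qed
    then obtain r where "\<forall>m. \<exists>s. A m \<subseteq> (\<Union>n. sel_Ioc f (r m n) (s n)) \<and>
        (\<Sum>n. ennreal \<bar>s n - r m n\<bar>) < ennreal (e / 2 * (1/2) ^ Suc m)"
      by (rule choice[THEN exE])
    then obtain s where "\<forall>m. A m \<subseteq> (\<Union>n. sel_Ioc f (r m n) (s m n)) \<and>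
        (\<Sum>n. ennreal \<bar>s m n - r m n\<bar>) < ennreal (e / 2 * (1/2) ^ Suc m)"
      by (rule choice[THEN exE])
    then have
      cov: "\<And>m. A m \<subseteq> (\<Union>n. sel_Ioc f (r m n) (s m n))" and
      cost: "\<And>m. (\<Sum>n. ennreal \<bar>s m n - r m n\<bar>) < ennreal (e / 2 * (1/2) ^ Suc m)"
      by simp_all
    define r' where "r' k = case_prod r (prod_decode k)" for k
    define s' where "s' k = case_prod s (prod_decode k)" for k
    have "(\<Union>m. A m) \<subseteq> (\<Union>k. sel_Ioc f (r' k) (s' k))"
    proof
      fix x assume "x \<in> (\<Union>m. A m)"
      then obtain m n where "x \<in> sel_Ioc f (r m n) (s m n)" using cov by blast
      then have "x \<in> sel_Ioc f (r' (prod_encode (m, n))) (s' (prod_encode (m, n)))"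
        by (simp add: r'_def s'_def)
      then show "x \<in> (\<Union>k. sel_Ioc f (r' k) (s' k))" by blast
    qed
    moreover have "(\<Sum>k. ennreal \<bar>s' k - r' k\<bar>) < ennreal e"
    proof -
      have "(\<Sum>k. ennreal \<bar>s' k - r' k\<bar>) = (\<Sum>m. \<Sum>n. ennreal \<bar>s m n - r m n\<bar>)"
        unfolding r'_def s'_def
        by (rule suminf_ennreal_2dimen[where
              f = "\<lambda>p. ennreal \<bar>case_prod s p - case_prod r p\<bar>" and
              g = "\<lambda>m. \<Sum>n. ennreal \<bar>s m n - r m n\<bar>"]) simp
      also have "\<dots> \<le> (\<Sum>m. ennreal (e / 2 * (1/2) ^ Suc m))"
        using cost by (intro suminf_le allI summableI less_imp_le)
      also have "\<dots> = ennreal (e / 2 * 1)"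
        using e by (intro suminf_ennreal_eq sums_mult power_half_series) auto
      also have "\<dots> < ennreal e" using e by (subst ennreal_less_iff) auto
      finally show ?thesis .
    qed
    ultimately show "\<exists>r s. (\<Union>m. A m) \<subseteq> (\<Union>n. sel_Ioc f (r n) (s n)) \<and>
        (\<Sum>n. ennreal \<bar>s n - r n\<bar>) < ennreal e"
      by (intro exI[of _ r'] exI[of _ s'] conjI)
  qed
qed

section \<open>Reversing comparisons\<close>

text \<open>
  Choosing \<open>Min\<close> gives the usual order; choosing \<open>Max\<close> reverses the comparison. Two-element sets
  that meet both \<open>M\<close> and the rationals above \<open>1\<close> are exactly the pairs to be reversed, provided that
  \<open>M \<subseteq> {..1}\<close>, since these two sets are then disjoint.
\<close>
definition flip_sel :: "real set \<Rightarrow> real set \<Rightarrow> real" where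
  "flip_sel M F =
     (if F \<inter> M \<noteq> {} \<and> F \<inter> {q \<in> \<rat>. q > 1} \<noteq> {} then Max F else Min F)"

lemma weak_selection_flip_sel: "weak_selection (flip_sel M)"
  unfolding weak_selection_def
proof (intro allI impI)
  fix F :: "real set" assume "card F = 2"
  then have "finite F" "F \<noteq> {}" by (auto intro: card_ge_0_finite)
  then show "flip_sel M F \<in> F" by (simp add: flip_sel_def)
qed

lemma sel_less_flip_sel:
  assumes "M \<subseteq> {..1}"
  shows "sel_less (flip_sel M) x y \<longleftrightarrow>
     (if x \<in> M \<and> y \<in> \<rat> \<and> y > 1 \<or> y \<in> M \<and> x \<in> \<rat> \<and> x > 1 then y < x else x < y)"
  using assms by (auto simp: sel_less_def flip_sel_def min_def max_def)

text \<open>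
  The reversed points form a dense set with dense complement in \<open>(1, \<infinity>)\<close>. So
  two arbitrarily close points \<open>2\<close> and \<open>t\<close> can be found, only the first of which is reversed,
  and all of \<open>M\<close> lies between them in the new order.
\<close>
lemma flipped_null:
  assumes M: "M \<subseteq> {..1}" and A: "A \<subseteq> M"
  shows "A \<in> sel_null (flip_sel M)"
  unfolding sel_null_iff
proof (intro allI impI)
  fix e :: real assume e: "e > 0"
  have "uncountable ({2<..<2 + e} - \<rat>)"
    using e by (intro uncountable_minus_countable countable_rat) (simp add: uncountable_open_interval)
  then obtain t where t: "t \<notin> \<rat>" "2 < t" "t < 2 + e"
    by (metis DiffE countable_empty ex_in_conv greaterThanLessThan_iff)
  have one: "A \<subseteq> sel_Ioc (flip_sel M) 2 t"
    using M A t by (auto simp: sel_Ioc_def sel_le_def sel_less_flip_sel[OF M])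
  \<comment> \<open>A single interval suffices; the remaining ones have length zero and cost nothing.\<close>
  define s where "s n = (if n = (0::nat) then t else 2)" for n
  have "A \<subseteq> (\<Union>n. sel_Ioc (flip_sel M) 2 (s n))"
    using one by (intro order_trans[OF _ UN_upper[of 0]]) (simp_all add: s_def)
  moreover have "(\<Sum>n. ennreal \<bar>s n - 2\<bar>) < ennreal e"
    using t by (subst suminf_finite[of "{0}"]) (auto simp: s_def ennreal_less_iff)
  ultimately show "\<exists>r s. A \<subseteq> (\<Union>n. sel_Ioc (flip_sel M) (r n) (s n)) \<and>
        (\<Sum>n. ennreal \<bar>s n - r n\<bar>) < ennreal e"
    by (intro exI[of _ "\<lambda>_. 2"] exI[of _ s] conjI)
qed

text \<open>
  A reversed comparison involving \<open>x \<le> 1\<close> needs \<open>x \<in> M\<close>, so \<open>x\<close> keeps its usual position with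
  respect to both endpoints.
\<close>
lemma sel_Ioc_flip_sel_unflipped:
  assumes "M \<subseteq> {..1}" "x \<le> 1" "x \<notin> M" "x \<in> sel_Ioc (flip_sel M) r s"
  shows "x \<in> {r <.. s}"
  using assms by (auto simp: sel_Ioc_def sel_le_def sel_less_flip_sel split: if_splits)

section \<open>Counting the ideals\<close>

text \<open>
  Here \<open>C\<close> is the set of cheap covers. The point \<open>h (c, i)\<close> belongs to \<open>B i\<close> and witnesses that
  \<open>c\<close> does not cover \<open>B i\<close>; injectivity of \<open>h\<close> makes the sets \<open>B i\<close> disjoint.
\<close>
lemma reals_lepoll_sel_null_ideals:
  "(UNIV :: real set set) \<lesssim>
     {I :: real set set. sigma_ideal I \<and> (\<exists>f. weak_selection f \<and> I = sel_null f)}"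
proof -
  define C :: "((nat \<Rightarrow> real) \<times> (nat \<Rightarrow> real)) set" where
    "C = {(r, s). (\<Sum>n. ennreal \<bar>s n - r n\<bar>) < ennreal (1/4)}"
  define K :: "((nat \<Rightarrow> real) \<times> (nat \<Rightarrow> real)) \<times> real \<Rightarrow> real set" where
    "K = (\<lambda>((r, s), i). {0..1} - (\<Union>n. {r n <.. s n}))"
  have "C \<times> (UNIV :: real set) \<lesssim> (UNIV :: real set)"
  proof -
    have "C \<lesssim> (UNIV :: (nat \<Rightarrow> real) set) \<times> (UNIV :: (nat \<Rightarrow> real) set)"
      by (rule subset_imp_lepoll) auto
    also have "\<dots> \<lesssim> (UNIV :: real set) \<times> (UNIV :: real set)"
      by (intro times_lepoll_mono real_sequences_lepoll_reals)
    also have "\<dots> \<approx> (UNIV :: real set)" by (rule Times_eqpoll_self) (rule infinite_UNIV_char_0)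
    finally have "C \<times> (UNIV :: real set) \<lesssim> (UNIV :: real set) \<times> (UNIV :: real set)"
      by (intro times_lepoll_mono lepoll_refl)
    also have "\<dots> \<approx> (UNIV :: real set)" by (rule Times_eqpoll_self) (rule infinite_UNIV_char_0)
    finally show ?thesis .
  qed
  then have "C \<times> (UNIV :: real set) \<lesssim> K a" if "a \<in> C \<times> UNIV" for a
    using that reals_lepoll_cover_complement by (auto simp: C_def K_def intro: lepoll_trans)
  then obtain h where h_inj: "inj_on h (C \<times> UNIV)" and h_in: "\<And>a. a \<in> C \<times> UNIV \<Longrightarrow> h a \<in> K a"
    using injective_choice[of "C \<times> UNIV" K] by blast
  define B where "B i = (\<lambda>c. h (c, i)) ` C" for i
  define M where "M S = (\<Union>i\<in>S. B i)" for S
  have B01: "B i \<subseteq> {0..1}" for i using h_in by (fastforce simp: B_def K_def)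
  then have M1: "M S \<subseteq> {..1}" for S by (fastforce simp: M_def)
  have "B i \<in> sel_null (flip_sel (M S)) \<longleftrightarrow> i \<in> S" for i S
  proof
    assume "i \<in> S"
    then show "B i \<in> sel_null (flip_sel (M S))"
      by (intro flipped_null M1) (auto simp: M_def)
  next
    assume null: "B i \<in> sel_null (flip_sel (M S))"
    show "i \<in> S"
    proof (rule ccontr)
      assume "i \<notin> S"
      obtain r s where cov: "B i \<subseteq> (\<Union>n. sel_Ioc (flip_sel (M S)) (r n) (s n))"
        and cost: "(\<Sum>n. ennreal \<bar>s n - r n\<bar>) < ennreal (1/4)"
        using null unfolding sel_null_iff by (meson zero_less_divide_1_iff zero_less_numeral)
      define x where "x = h ((r, s), i)"
      have rs: "(r, s) \<in> C" using cost by (simp add: C_def)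
      then have xB: "x \<in> B i" by (auto simp: B_def x_def)
      have "x \<notin> M S"
      proof
        assume "x \<in> M S"
        then obtain j c where "j \<in> S" "c \<in> C" "x = h (c, j)" by (auto simp: M_def B_def)
        then have "((r, s), i) = (c, j)"
          using inj_onD[OF h_inj, of "((r, s), i)" "(c, j)"] rs x_def by simp
        with \<open>j \<in> S\<close> \<open>i \<notin> S\<close> show False by simp
      qed
      moreover have "x \<le> 1" using xB B01 by fastforce
      moreover obtain n where "x \<in> sel_Ioc (flip_sel (M S)) (r n) (s n)" using cov xB by blast
      ultimately have "x \<in> {r n <.. s n}" using sel_Ioc_flip_sel_unflipped[OF M1] by blast
      moreover have "x \<notin> {r n <.. s n}" using h_in[of "((r, s), i)"] rs by (auto simp: K_def x_def)
      ultimately show False by blast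
    qed
  qed
  then have "inj (\<lambda>S. sel_null (flip_sel (M S)))" by (intro injI) (metis subsetI subset_antisym)
  then show ?thesis
    unfolding lepoll_def using sigma_ideal_sel_null weak_selection_flip_sel by blast
qed

text \<open>
  \<open>N\<close> is the null ideal computed from the order relation alone. Passing through it matters: the
  bare inclusion into \<open>real set set set\<close> would only give the bound \<open>2 ^ 2 ^ \<cc>\<close>.
\<close>
lemma sel_null_ideals_lepoll_reals:
  "{I :: real set set. sigma_ideal I \<and> (\<exists>f. weak_selection f \<and> I = sel_null f)}
     \<lesssim> (UNIV :: real set set)"
proof -
  define N where "N R = {A. Inf {(\<Sum>n. ennreal \<bar>s n - r n\<bar>) | r s :: nat \<Rightarrow> real.
     A \<subseteq> (\<Union>n. {x. (r n, x) \<in> R \<and> ((x, s n) \<in> R \<or> x = s n)})} = 0}" for R :: "(real \<times> real) set"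
  have "sel_null f = N {(x, y). sel_less f x y}" for f
    by (simp add: N_def sel_null_def sel_outer_def sel_Ioc_def sel_le_def)
  then have "{I. sigma_ideal I \<and> (\<exists>f. weak_selection f \<and> I = sel_null f)} \<subseteq> range N"
    by blast
  then have "{I. sigma_ideal I \<and> (\<exists>f. weak_selection f \<and> I = sel_null f)}
      \<lesssim> (UNIV :: (real \<times> real) set set)"
    by (meson subset_imp_lepoll image_lepoll lepoll_trans)
  also have "\<dots> \<lesssim> (UNIV :: real set set)"
  proof -
    have "(UNIV :: (real \<times> real) set) \<lesssim> (UNIV :: real set)"
      using Times_eqpoll_self[OF infinite_UNIV_char_0, where 'a1 = real]
      by (simp add: eqpoll_imp_lepoll)
    then obtain g :: "real \<times> real \<Rightarrow> real" where "inj g" unfolding lepoll_def by blast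
    then have "inj (image g)" by (intro injI) (simp add: inj_image_eq_iff)
    then show ?thesis unfolding lepoll_def by blast
  qed
  finally show ?thesis .
qed

theorem corollary1p3:
  "{I :: real set set. sigma_ideal I \<and> (\<exists>f. weak_selection f \<and> I = sel_null f)}
     \<approx> (UNIV :: real set set)"
  by (intro lepoll_antisym sel_null_ideals_lepoll_reals reals_lepoll_sel_null_ideals)

end
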